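(* Let $N\ge 1$ be an integer, and let $j,m$ be integers with $0\le j\le N$ and $0\le m\le N$. Then $$\sum_{n=0}^m (N-2n)\,(\Phi^{N}_{n\,j})^2=(N-j)\,(\Phi^{N-1}_{m\,j})^2+j\,(\Phi^{N-1}_{m\,j-1})^2 .$$
   Context: For an integer $N\ge 0$ and an integer $0\le j\le N$, the symmetric Krawtchouk values $\Phi^{N}_{n\,j}$ are defined by the generating function $$(1+z)^{N-j}(1-z)^j=\sum_{n=0}^N z^n\,\Phi^{N}_{n\,j},$$ with $\Phi^{N}_{n\,j}=0$ when $n<0$ or $n>N$. Terms whose column index is out of range ($\Phi^{N-1}_{m\,j}$ for $j=N$ and $\Phi^{N-1}_{m\,j-1}$ for $j=0$) are multiplied by a zero coefficient and are read as $0$. *)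

theory Defs
  imports "HOL-Computational_Algebra.Polynomial"
begin

text \<open>
  The value \<open>\<Phi>\<^sup>N\<^sub>n\<^sub>j\<close> is the coefficient of \<open>z\<^sup>n\<close> in the polynomial
  \<open>(1 + z)\<^bsup>N-j\<^esup> (1 - z)\<^bsup>j\<^esup>\<close>. Row and column indices are integers, so that \<open>n < 0\<close> and the
  column \<open>j - 1\<close> for \<open>j = 0\<close> are really out of range; the value there is \<open>0\<close>. For \<open>n > N\<close> it is
  \<open>0\<close> because the polynomial has degree \<open>N\<close>.
\<close>

definition krawtchouk :: "nat \<Rightarrow> int \<Rightarrow> int \<Rightarrow> int" where
  "krawtchouk N n j =
     (if 0 \<le> n \<and> 0 \<le> j \<and> j \<le> int N
      then coeff ([:1, 1:] ^ nat (int N - j) * [:1, - 1:] ^ nat j) (nat n)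
      else 0)"

lemma degree_krawtchouk_gf:
  assumes "0 \<le> j" "j \<le> int N"
  shows "degree ([:1, 1:] ^ nat (int N - j) * [:1, - 1:] ^ nat j :: int poly) = N"
  using assms by (simp add: degree_mult_eq degree_power_eq)

lemma krawtchouk_above:
  assumes "n > int N"
  shows "krawtchouk N n j = 0"
proof (cases "0 \<le> j \<and> j \<le> int N")
  case True
  then have "degree ([:1, 1:] ^ nat (int N - j) * [:1, - 1:] ^ nat j :: int poly) < nat n"
    using degree_krawtchouk_gf[of j N] assms by linarith
  then show ?thesis
    unfolding krawtchouk_def by (simp add: coeff_eq_0)
qed (auto simp: krawtchouk_def)

lemma krawtchouk_generating_function:
  fixes z :: int
  assumes "0 \<le> j" "j \<le> int N"
  shows "(1 + z) ^ nat (int N - j) * (1 - z) ^ nat j = (\<Sum>n\<le>N. z ^ n * krawtchouk N (int n) j)"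
proof -
  let ?p = "[:1, 1:] ^ nat (int N - j) * [:1, - 1:] ^ nat j :: int poly"
  have "(1 + z) ^ nat (int N - j) * (1 - z) ^ nat j = poly ?p z"
    by simp
  also have "\<dots> = (\<Sum>n\<le>N. coeff ?p n * z ^ n)"
    using degree_krawtchouk_gf[OF assms] by (subst poly_altdef) metis
  also have "\<dots> = (\<Sum>n\<le>N. z ^ n * krawtchouk N (int n) j)"
    using assms by (simp add: krawtchouk_def mult.commute)
  finally show ?thesis .
qed

end

theory Submission
  imports Defs
begin

text \<open>
  Write \<open>a = N - j\<close>, \<open>b = j\<close>, \<open>p = (1 + z)\<^sup>a (1 - z)\<^sup>b\<close>, and let \<open>q\<close> and \<open>r\<close> be \<open>p\<close> with one factor
  \<open>1 + z\<close>, respectively \<open>1 - z\<close>, removed. The sum telescopes: since \<open>p = (1 + z) q = (1 - z) r\<close>, the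
  increment of the right-hand side at \<open>n\<close> is \<open>p\<^sub>n\<close> times the coefficient of \<open>z\<^sup>n\<close> in
  \<open>a (1 - z) q + b (1 + z) r\<close>, and this polynomial is \<open>N p - 2 z p'\<close>.
\<close>

text \<open>The factors \<open>of_nat a\<close> and \<open>of_nat b\<close> cover the boundary: for
  \<open>a = 0\<close>, truncated subtraction makes \<open>q\<close> equal to \<open>p\<close>
  rather than a quotient, and only the zero factor keeps the identities true; likewise
  \<open>r\<close> for \<open>b = 0\<close>.\<close>

lemma krawtchouk_gf_euler:
  fixes a b :: nat
  defines "p \<equiv> [:1, 1:] ^ a * [:1, - 1:] ^ b :: int poly"
    and "q \<equiv> [:1, 1:] ^ (a - 1) * [:1, - 1:] ^ b :: int poly"
    and "r \<equiv> [:1, 1:] ^ a * [:1, - 1:] ^ (b - 1) :: int poly"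
  shows "of_nat a * p = of_nat a * ([:1, 1:] * q)"
    and "of_nat b * p = of_nat b * ([:1, - 1:] * r)"
    and "pderiv p = of_nat a * q - of_nat b * r"
proof -
  show "of_nat a * p = of_nat a * ([:1, 1:] * q)"
    unfolding p_def q_def by (cases a) (simp_all add: mult.assoc del: mult_pCons_left)
  show "of_nat b * p = of_nat b * ([:1, - 1:] * r)"
    unfolding p_def r_def by (cases b) (simp_all add: mult_ac del: mult_pCons_left mult_pCons_right)
  have "pderiv ([:1, 1:] ^ a :: int poly) = of_nat a * [:1, 1:] ^ (a - 1)"
    by (simp add: pderiv_power pderiv_pCons of_nat_poly)
  moreover have "pderiv ([:1, - 1:] ^ b :: int poly) = - (of_nat b * [:1, - 1:] ^ (b - 1))"
    by (simp add: pderiv_power pderiv_pCons of_nat_poly)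
  ultimately show "pderiv p = of_nat a * q - of_nat b * r"
    unfolding p_def q_def r_def pderiv_mult by (simp add: algebra_simps)
qed

lemma coeff_of_nat_mult:
  "coeff (of_nat k * p) n = of_nat k * coeff p n" for p :: "'a::comm_semiring_1 poly"
  by (simp add: of_nat_poly)

text \<open>The coefficient of \<open>pCons 0 s\<close> at \<open>n\<close> is that of \<open>s\<close> at \<open>n - 1\<close>, read as \<open>0\<close> for \<open>n = 0\<close>.\<close>

lemma krawtchouk_gf_increment:
  fixes a b n :: nat
  defines "p \<equiv> [:1, 1:] ^ a * [:1, - 1:] ^ b :: int poly"
    and "q \<equiv> [:1, 1:] ^ (a - 1) * [:1, - 1:] ^ b :: int poly"
    and "r \<equiv> [:1, 1:] ^ a * [:1, - 1:] ^ (b - 1) :: int poly"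
  shows "(int (a + b) - 2 * int n) * (coeff p n)\<^sup>2 =
    int a * ((coeff q n)\<^sup>2 - (coeff (pCons 0 q) n)\<^sup>2) +
    int b * ((coeff r n)\<^sup>2 - (coeff (pCons 0 r) n)\<^sup>2)"
proof -
  note euler = krawtchouk_gf_euler[where a = a and b = b, folded p_def q_def r_def]
  let ?P = "coeff p n" and ?Q = "coeff q n" and ?R = "coeff r n"
  let ?Q' = "coeff (pCons 0 q) n" and ?R' = "coeff (pCons 0 r) n"
  have aP: "int a * ?P = int a * (?Q + ?Q')"
    using arg_cong[OF euler(1), of "\<lambda>s. coeff s n"] by (simp only: coeff_of_nat_mult) simp
  have bP: "int b * ?P = int b * (?R - ?R')"
    using arg_cong[OF euler(2), of "\<lambda>s. coeff s n"]
    by (simp only: coeff_of_nat_mult) (simp add: coeff_pCons split: nat.splits)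
  \<comment> \<open>This reads off the coefficient of z p'. At \<open>n = 0\<close> both sides
    vanish, since the shifted coefficients are 0 there.\<close>
  have nP: "int n * ?P = int a * ?Q' - int b * ?R'"
  proof (cases n)
    case (Suc k)
    have "coeff (pderiv p) k = int a * coeff q k - int b * coeff r k"
      by (simp only: euler(3) coeff_diff coeff_of_nat_mult)
    then show ?thesis
      by (simp add: Suc coeff_pderiv)
  qed simp
  have "(int (a + b) - 2 * int n) * ?P = int a * ?P + int b * ?P - 2 * (int n * ?P)"
    by (simp add: algebra_simps)
  also have "\<dots> = int a * (?Q - ?Q') + int b * (?R + ?R')"
    unfolding aP bP nP by (simp add: algebra_simps)
  finally have "(int (a + b) - 2 * int n) * ?P * ?P =
      (int a * (?Q - ?Q') + int b * (?R + ?R')) * ?P"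
    by (rule arg_cong)
  \<comment> \<open>The extra factor \<open>?P\<close> is split differently in the two terms: as
    \<open>?Q + ?Q'\<close> next to \<open>int a\<close> and as \<open>?R - ?R'\<close> next to
    \<open>int b\<close>, so that both become differences of squares.\<close>
  also have "\<dots> = (int a * ?P) * (?Q - ?Q') + (int b * ?P) * (?R + ?R')"
    by (simp add: algebra_simps)
  also have "\<dots> = int a * (?Q\<^sup>2 - ?Q'\<^sup>2) + int b * (?R\<^sup>2 - ?R'\<^sup>2)"
    unfolding aP bP by (simp add: power2_eq_square algebra_simps)
  finally show ?thesis
    by (simp only: power2_eq_square mult.assoc)
qed

lemma sum_krawtchouk_gf_coeff_squares:
  fixes a b m :: nat
  shows "(\<Sum>n\<le>m. (int (a + b) - 2 * int n) * (coeff ([:1, 1:] ^ a * [:1, - 1:] ^ b) n)\<^sup>2) =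
    int a * (coeff ([:1, 1:] ^ (a - 1) * [:1, - 1:] ^ b) m)\<^sup>2 +
    int b * (coeff ([:1, 1:] ^ a * [:1, - 1:] ^ (b - 1)) m)\<^sup>2"
proof (induction m)
  case 0
  show ?case
    using krawtchouk_gf_increment[of a b 0] by simp
next
  case (Suc m)
  \<comment> \<open>The shifted coefficients at \<open>Suc m\<close> are those of the unshifted
    polynomials at \<open>m\<close>, so their squares cancel the induction hypothesis.\<close>
  show ?case
    unfolding sum.atMost_Suc Suc.IH
    unfolding krawtchouk_gf_increment coeff_pCons_Suc
    by (simp add: algebra_simps)
qed

theorem theorem4p3:
  fixes N :: nat and j m :: int
  assumes "N \<ge> 1"
    and "0 \<le> j" and "j \<le> int N"
    and "0 \<le> m" and "m \<le> int N"
  shows "(\<Sum>n = 0..m. (int N - 2 * n) * (krawtchouk N n j)\<^sup>2) =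
    (int N - j) * (krawtchouk (N - 1) m j)\<^sup>2 + j * (krawtchouk (N - 1) m (j - 1))\<^sup>2"
proof -
  define a b where "a = nat (int N - j)" and "b = nat j"
  have ab: "int a = int N - j" "int b = j" "int (a + b) = int N"
    using assms by (auto simp: a_def b_def)
  have "(\<Sum>n = 0..m. (int N - 2 * n) * (krawtchouk N n j)\<^sup>2) =
      (\<Sum>n\<le>nat m. (int N - 2 * int n) * (krawtchouk N (int n) j)\<^sup>2)"
    by (rule sum.reindex_bij_witness[of _ int nat]) (use assms in auto)
  also have "\<dots> = (\<Sum>n\<le>nat m. (int (a + b) - 2 * int n) *
      (coeff ([:1, 1:] ^ a * [:1, - 1:] ^ b) n)\<^sup>2)"
    unfolding ab(3) using assms by (simp add: krawtchouk_def a_def b_def)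
  also note sum_krawtchouk_gf_coeff_squares
  also have "int a * (coeff ([:1, 1:] ^ (a - 1) * [:1, - 1:] ^ b) (nat m))\<^sup>2 =
      (int N - j) * (krawtchouk (N - 1) m j)\<^sup>2"
  \<comment> \<open>For \<open>j = int N\<close> the factor \<open>int a\<close> is 0; otherwise
    \<open>a\<close> is positive and \<open>a - 1\<close> is the true exponent in row
    \<open>N - 1\<close>.\<close>
  proof (cases "j = int N")
    case False
    then have "nat (int (N - 1) - j) = a - 1" "j \<le> int (N - 1)"
      using assms by (auto simp: a_def)
    then show ?thesis
      using assms by (simp add: krawtchouk_def ab b_def)
  qed (simp add: ab)
  also have "int b * (coeff ([:1, 1:] ^ a * [:1, - 1:] ^ (b - 1)) (nat m))\<^sup>2 =
      j * (krawtchouk (N - 1) m (j - 1))\<^sup>2"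
  proof (cases "j = 0")
    case False
    then have "nat (int (N - 1) - (j - 1)) = a" "nat (j - 1) = b - 1" "j - 1 \<le> int (N - 1)"
      using assms by (auto simp: a_def b_def)
    then show ?thesis
      using assms False by (simp add: krawtchouk_def ab)
  qed (simp add: ab)
  finally show ?thesis .
qed

end
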